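(* Let $G$ be a finite connected graph and let $\mathcal{P}_0$ be the all-singleton partition of $E(G)$ (each edge is its own class). Then the binary quotient labeling $\lambda$ of $\mathcal{P}_0$ is isometric: $d_{\mathrm{Cay}}(\lambda(u),\lambda(v))=d_G(u,v)$ for all $u,v\in V(G)$.
   Context: $d_G$ is the shortest-path metric. For a partition $\{F_1,\dots,F_t\}$ of $E(G)$ and a cycle basis $B_1,\dots,B_c$ of $G$ (cycles whose edge sets form a basis over $\mathbb{F}_2$ of the cycle space), the cycle–class parity matrix is $A\in\mathbb{F}_2^{c\times t}$, $A[i,j]=|F_j\cap E(B_i)|\bmod 2$. The binary quotient labeling of the partition is obtained as follows: let $\pi\colon\mathbb{Z}_2^t\to\mathbb{Z}_2^t/\mathrm{rowspan}(A)\cong\mathbb{Z}_2^k$ be the quotient map, $g_j=\pi(e_j)$ for the standard basis vectors $e_j$, and $\lambda(v)=\sum_{e\in P(r,v)}g_{\mathrm{class}(e)}$ along any path $P(r,v)$ from a fixed root $r$ to $v$ (this is independent of the path), where $\mathrm{class}(e)=j$ if $e\in F_j$. The host is $\mathrm{Cay}(\mathbb{Z}_2^k,S)$ with $S=\{g_j:g_j\ne0\}$, the graph on $\mathbb{Z}_2^k$ with edges $\{h,h+s\}$, $s\in S$, and $d_{\mathrm{Cay}}$ is its graph metric. *)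

theory Defs
  imports
    "HOL-Algebra.Coset"
    "HOL-Library.Z2"
    "HOL-Library.Function_Algebras"
    "HOL-Library.Disjoint_Sets"
    "HOL-Library.Indicator_Function"
    "HOL-Library.Extended_Nat"
begin

section \<open>Graphs\<close>

definition simple_graph :: "'a set \<Rightarrow> 'a set set \<Rightarrow> bool" where
  "simple_graph V E \<longleftrightarrow> (\<forall>e\<in>E. \<exists>u\<in>V. \<exists>v\<in>V. u \<noteq> v \<and> e = {u, v})"

text \<open>Paths and cycles are given by their lists of pairwise distinct vertices; a cycle is closed up
  by the edge between its last and its first vertex.\<close>

definition path :: "'a set \<Rightarrow> 'a set set \<Rightarrow> 'a list \<Rightarrow> bool" where
  "path V E p \<longleftrightarrow> p \<noteq> [] \<and> set p \<subseteq> V \<and> distinct p \<and> successively (\<lambda>x y. {x, y} \<in> E) p"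

definition path_between :: "'a set \<Rightarrow> 'a set set \<Rightarrow> 'a \<Rightarrow> 'a list \<Rightarrow> 'a \<Rightarrow> bool" where
  "path_between V E u p v \<longleftrightarrow> path V E p \<and> hd p = u \<and> last p = v"

definition path_edges :: "'a list \<Rightarrow> 'a set list" where
  "path_edges p = map2 (\<lambda>x y. {x, y}) p (tl p)"

definition cycle :: "'a set \<Rightarrow> 'a set set \<Rightarrow> 'a list \<Rightarrow> bool" where
  "cycle V E p \<longleftrightarrow> path V E p \<and> 3 \<le> length p \<and> {last p, hd p} \<in> E"

definition cycle_edges :: "'a list \<Rightarrow> 'a set set" where
  "cycle_edges p = insert {last p, hd p} (set (path_edges p))"

definition connected_graph :: "'a set \<Rightarrow> 'a set set \<Rightarrow> bool" where
  "connected_graph V E \<longleftrightarrow> V \<noteq> {} \<and> (\<forall>u\<in>V. \<forall>v\<in>V. \<exists>p. path_between V E u p v)"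

text \<open>The shortest-path metric; it is \<open>\<infinity>\<close> between vertices that no path joins.\<close>

definition graph_dist :: "'a set \<Rightarrow> 'a set set \<Rightarrow> 'a \<Rightarrow> 'a \<Rightarrow> enat" where
  "graph_dist V E u v = (INF p \<in> {p. path_between V E u p v}. enat (length (path_edges p)))"

section \<open>Vector spaces over the two-element field\<close>

definition F2_scale :: "bit \<Rightarrow> ('i \<Rightarrow> bit) \<Rightarrow> ('i \<Rightarrow> bit)" where
  "F2_scale c x = (\<lambda>i. c * x i)"

global_interpretation F2: vector_space F2_scale
  by unfold_locales (auto simp: F2_scale_def fun_eq_iff algebra_simps)

text \<open>The group \<open>\<int>\<^sub>2\<^sup>n\<close>: a vector with coordinates \<open>0, \<dots>, n - 1\<close> is a function on \<open>nat\<close>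
  that vanishes from \<open>n\<close> on.\<close>

definition Z2_pow :: "nat \<Rightarrow> (nat \<Rightarrow> bit) monoid" where
  "Z2_pow n = \<lparr>carrier = {x. \<forall>i\<ge>n. x i = 0}, mult = (+), one = 0\<rparr>"

section \<open>Cycle bases and the parity matrix\<close>

text \<open>The cycle space consists of the even-degree edge sets. An edge set \<open>X\<close> is identified with
  its indicator function, a vector over the two-element field indexed by edges.\<close>

definition cycle_space :: "'a set \<Rightarrow> 'a set set \<Rightarrow> ('a set \<Rightarrow> bit) set" where
  "cycle_space V E = {indicator X | X. X \<subseteq> E \<and> (\<forall>v\<in>V. even (card {e \<in> X. v \<in> e}))}"

definition cycle_basis :: "'a set \<Rightarrow> 'a set set \<Rightarrow> 'a list list \<Rightarrow> bool" where
  "cycle_basis V E Bs \<longleftrightarrow>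
     (\<forall>B\<in>set Bs. cycle V E B) \<and>
     (let vs = map (\<lambda>B. indicator (cycle_edges B) :: 'a set \<Rightarrow> bit) Bs in
        distinct vs \<and> F2.independent (set vs) \<and> F2.span (set vs) = cycle_space V E)"

definition edge_partition :: "'a set set \<Rightarrow> 'a set set list \<Rightarrow> bool" where
  "edge_partition E Fs \<longleftrightarrow> distinct Fs \<and> partition_on E (set Fs)"

definition edge_class :: "'a set set list \<Rightarrow> 'a set \<Rightarrow> nat" where
  "edge_class Fs e = (THE j. j < length Fs \<and> e \<in> Fs ! j)"

text \<open>Rows and columns are numbered from \<open>0\<close>; \<open>of_nat\<close> into \<open>bit\<close> is reduction modulo \<open>2\<close>.
  Entries outside the range of the indices are \<open>0\<close>, so that the rows lie in \<open>\<int>\<^sub>2\<^sup>t\<close> with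
  \<open>t = length Fs\<close>.\<close>

definition parity_matrix :: "'a list list \<Rightarrow> 'a set set list \<Rightarrow> nat \<Rightarrow> nat \<Rightarrow> bit" where
  "parity_matrix Bs Fs i j =
     (if i < length Bs \<and> j < length Fs then of_nat (card (Fs ! j \<inter> cycle_edges (Bs ! i))) else 0)"

definition rowspan :: "'a list list \<Rightarrow> 'a set set list \<Rightarrow> (nat \<Rightarrow> bit) set" where
  "rowspan Bs Fs = F2.span (parity_matrix Bs Fs ` {..<length Bs})"

section \<open>The binary quotient labeling\<close>

definition quotient_group :: "'a list list \<Rightarrow> 'a set set list \<Rightarrow> (nat \<Rightarrow> bit) set monoid" where
  "quotient_group Bs Fs = Z2_pow (length Fs) Mod rowspan Bs Fs"

text \<open>Below, \<open>\<phi>\<close> is the chosen isomorphism from \<open>quotient_group Bs Fs\<close> to \<open>\<int>\<^sub>2\<^sup>k\<close>.\<close>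

definition quotient_map ::
    "((nat \<Rightarrow> bit) set \<Rightarrow> (nat \<Rightarrow> bit)) \<Rightarrow> 'a list list \<Rightarrow> 'a set set list \<Rightarrow> (nat \<Rightarrow> bit) \<Rightarrow> (nat \<Rightarrow> bit)"
  where "quotient_map \<phi> Bs Fs x = \<phi> (rowspan Bs Fs #>\<^bsub>Z2_pow (length Fs)\<^esub> x)"

definition generator ::
    "((nat \<Rightarrow> bit) set \<Rightarrow> (nat \<Rightarrow> bit)) \<Rightarrow> 'a list list \<Rightarrow> 'a set set list \<Rightarrow> nat \<Rightarrow> (nat \<Rightarrow> bit)"
  where "generator \<phi> Bs Fs j = quotient_map \<phi> Bs Fs (indicator {j})"

text \<open>\<open>P v\<close> is the path from the root to \<open>v\<close> along which the label of \<open>v\<close> is computed.\<close>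

definition quotient_labeling ::
    "((nat \<Rightarrow> bit) set \<Rightarrow> (nat \<Rightarrow> bit)) \<Rightarrow> 'a list list \<Rightarrow> 'a set set list \<Rightarrow> ('a \<Rightarrow> 'a list)
      \<Rightarrow> 'a \<Rightarrow> (nat \<Rightarrow> bit)"
  where "quotient_labeling \<phi> Bs Fs P v = (\<Sum>e\<leftarrow>path_edges (P v). generator \<phi> Bs Fs (edge_class Fs e))"

definition connection_set ::
    "((nat \<Rightarrow> bit) set \<Rightarrow> (nat \<Rightarrow> bit)) \<Rightarrow> 'a list list \<Rightarrow> 'a set set list \<Rightarrow> (nat \<Rightarrow> bit) set"
  where "connection_set \<phi> Bs Fs =
    {generator \<phi> Bs Fs j | j. j < length Fs \<and> generator \<phi> Bs Fs j \<noteq> 0}"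

definition cayley_edges :: "nat \<Rightarrow> (nat \<Rightarrow> bit) set \<Rightarrow> (nat \<Rightarrow> bit) set set" where
  "cayley_edges k S = {{h, h + s} | h s. h \<in> carrier (Z2_pow k) \<and> s \<in> S}"

definition cayley_dist :: "nat \<Rightarrow> (nat \<Rightarrow> bit) set \<Rightarrow> (nat \<Rightarrow> bit) \<Rightarrow> (nat \<Rightarrow> bit) \<Rightarrow> enat" where
  "cayley_dist k S = graph_dist (carrier (Z2_pow k)) (cayley_edges k S)"

end

theory Submission
  imports Defs
begin

text \<open>
  A list of edges has the label sum \<open>0\<close> if and only if every vertex lies on an even number of them,
  because the row space of the parity matrix is the cycle space. Hence the label sum along a
  \<open>u\<close>-\<open>v\<close> path depends only on \<open>u\<close> and \<open>v\<close>, and \<open>\<lambda>\<close> maps paths of \<open>G\<close> to walks of the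
  Cayley graph. Conversely, a Cayley path from \<open>\<lambda>(u)\<close> to \<open>\<lambda>(v)\<close> spells a list of edges of \<open>G\<close>
  whose odd-degree vertices are exactly \<open>u\<close> and \<open>v\<close>. Following unused edges of this list from
  \<open>u\<close> must end in \<open>v\<close>, so the list contains the edges of a \<open>u\<close>-\<open>v\<close> path.
\<close>

text \<open>These rules replace the field operations on \<open>bit\<close> by bitwise ones, to which the laws of
  commutative groups do not apply.\<close>

declare add_bit_eq_xor [simp del] mult_bit_eq_and [simp del]

section \<open>Vectors over the two-element field\<close>

lemma bit_add_self [simp]: "(a :: bit) + a = 0"
  by (cases a) simp_all

lemma bit_fun_add_self [simp]: "(x :: 'i \<Rightarrow> bit) + x = 0"
  by (simp add: fun_eq_iff)

lemma bit_fun_add_eq_iff: "(x :: 'i \<Rightarrow> bit) + y = z \<longleftrightarrow> y = x + z"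
  by (auto simp flip: add.assoc)

lemma of_nat_bit_eq_0_iff: "(of_nat n :: bit) = 0 \<longleftrightarrow> even n"
  by (induction n) auto

lemma group_Z2_pow: "group (Z2_pow n)"
proof (rule groupI)
  fix x assume "x \<in> carrier (Z2_pow n)"
  then show "\<exists>y\<in>carrier (Z2_pow n). y \<otimes>\<^bsub>Z2_pow n\<^esub> x = \<one>\<^bsub>Z2_pow n\<^esub>"
    by (intro bexI[of _ x]) (simp_all add: Z2_pow_def)
qed (simp_all add: Z2_pow_def add.assoc)

lemma comm_group_Z2_pow: "comm_group (Z2_pow n)"
  by (rule group.group_comm_groupI[OF group_Z2_pow]) (simp add: Z2_pow_def add.commute)

lemma Z2_pow_closed:
  "x \<in> carrier (Z2_pow n) \<Longrightarrow> y \<in> carrier (Z2_pow n) \<Longrightarrow> x + y \<in> carrier (Z2_pow n)"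
  "0 \<in> carrier (Z2_pow n)"
  by (simp_all add: Z2_pow_def)

lemma Z2_pow_sum_list_closed:
  "(\<And>a. a \<in> set as \<Longrightarrow> f a \<in> carrier (Z2_pow n)) \<Longrightarrow> (\<Sum>a\<leftarrow>as. f a) \<in> carrier (Z2_pow n)"
  by (induction as) (auto intro: Z2_pow_closed)

text \<open>Every element of \<open>Z2_pow n\<close> is its own inverse, so closure under addition
  already gives closure under inverses.\<close>

lemma subgroup_Z2_powI:
  assumes "F2.subspace H" "H \<subseteq> carrier (Z2_pow n)"
  shows "subgroup H (Z2_pow n)"
proof (rule group.subgroupI[OF group_Z2_pow assms(2)])
  show "H \<noteq> {}"
    using F2.subspace_0[OF assms(1)] by auto
next
  fix a assume a: "a \<in> H"
  have "inv\<^bsub>Z2_pow n\<^esub> a = a"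
    using a assms(2) group.inv_equality[OF group_Z2_pow, where x = a and y = a] by (auto simp: Z2_pow_def)
  then show "inv\<^bsub>Z2_pow n\<^esub> a \<in> H"
    using a by simp
next
  fix a b assume "a \<in> H" "b \<in> H"
  then show "a \<otimes>\<^bsub>Z2_pow n\<^esub> b \<in> H"
    using F2.subspace_add[OF assms(1)] by (simp add: Z2_pow_def)
qed

section \<open>Paths and edge lists\<close>

lemma path_edges_simps [simp]:
  "path_edges [] = []"
  "path_edges [x] = []"
  "path_edges (x # y # p) = {x, y} # path_edges (y # p)"
  by (simp_all add: path_edges_def)

lemma set_path_edges_subset:
  "successively (\<lambda>x y. {x, y} \<in> E) p \<Longrightarrow> set (path_edges p) \<subseteq> E"
  by (induction p rule: induct_list012) auto

lemma length_path_edges: "length (path_edges p) = length p - 1"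
  by (simp add: path_edges_def)

lemma path_between_refl: "u \<in> V \<Longrightarrow> path_between V E u [u] u"
  by (simp add: path_between_def path_def)

text \<open>If \<open>u\<close> already lies on \<open>p\<close>, prepending it would repeat a
  vertex; the suffix of \<open>p\<close> that starts at \<open>u\<close> is taken instead. Hence the
  length is only bounded from above.\<close>

lemma path_between_Cons:
  assumes "path_between V E w p v" "u \<in> V" "{u, w} \<in> E"
  obtains q where "path_between V E u q v"
    "length (path_edges q) \<le> Suc (length (path_edges p))"
proof (cases "u \<in> set p")
  case True
  then obtain p1 p2 where p: "p = p1 @ u # p2"
    by (meson split_list)
  show thesis
    by (rule that[of "u # p2"])
      (use assms p in \<open>auto simp: path_between_def path_def successively_append_iff length_path_edges\<close>)
next
  case False
  show thesis
    by (rule that[of "u # p"])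
      (use assms False in \<open>auto simp: path_between_def path_def successively_Cons length_path_edges\<close>)
qed

lemma graph_dist_le:
  "path_between V E u p v \<Longrightarrow> length (path_edges p) \<le> n \<Longrightarrow> graph_dist V E u v \<le> enat n"
  unfolding graph_dist_def by (rule INF_lower2[of p]) auto

text \<open>Used for the image of a path under the labeling, which can thus be treated as a mere
  walk, without a proof that its vertices are distinct.\<close>

lemma walk_contains_path:
  assumes "p \<noteq> []" "set p \<subseteq> V" "successively (\<lambda>x y. {x, y} \<in> E) p"
  shows "\<exists>q. path_between V E (hd p) q (last p) \<and> length (path_edges q) \<le> length (path_edges p)"
  using assms
proof (induction p rule: induct_list012)
  case (2 x)
  then show ?case
    using path_between_refl[of x V E] by (auto intro!: exI[of _ "[x]"])
next
  case (3 x y p)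
  then obtain q where q: "path_between V E y q (last (y # p))"
      "length (path_edges q) \<le> length (path_edges (y # p))"
    by auto
  obtain q' where "path_between V E x q' (last (y # p))"
      "length (path_edges q') \<le> Suc (length (path_edges q))"
    by (rule path_between_Cons[OF q(1), of x]) (use 3 in auto)
  then show ?case
    using q(2) by (intro exI[of _ q']) auto
qed auto

section \<open>Boundaries of edge lists modulo 2\<close>

text \<open>The boundary map of the graph over F_2. It acts on lists because a Cayley path may use
  the same generator several times.\<close>

definition boundary :: "'a set list \<Rightarrow> 'a \<Rightarrow> bit" where
  "boundary es x = (\<Sum>e\<leftarrow>es. of_bool (x \<in> e))"

lemma boundary_simps [simp]:
  "boundary [] x = 0"
  "boundary (e # es) x = of_bool (x \<in> e) + boundary es x"
  "boundary (es @ es') x = boundary es x + boundary es' x"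
  by (simp_all add: boundary_def)

lemma boundary_remove1:
  "e \<in> set es \<Longrightarrow> boundary es x = of_bool (x \<in> e) + boundary (remove1 e es) x"
  unfolding boundary_def by (rule sum_list_map_remove1)

text \<open>Inner vertices lie on two edges of the path and cancel. For a one-vertex path the two
  end terms cancel each other.\<close>

lemma boundary_path_edges:
  "p \<noteq> [] \<Longrightarrow> distinct p \<Longrightarrow> boundary (path_edges p) x = of_bool (x = hd p) + of_bool (x = last p)"
proof (induction p rule: induct_list012)
  case (3 y z p)
  then have "boundary (path_edges (y # z # p)) x
      = of_bool (x \<in> {y, z}) + (of_bool (x = z) + of_bool (x = last (z # p)))"
    by auto
  \<comment> \<open>Distinctness gives \<open>y \<noteq> z\<close>, so the two indicators never add
    up to 1 + 1.\<close>
  also have "of_bool (x \<in> {y, z}) = (of_bool (x = y) + of_bool (x = z) :: bit)"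
    using 3 by auto
  finally show ?case
    by (cases "x = z") (auto simp: add.assoc)
qed auto

text \<open>Induction on the number of edges: an edge at the odd vertex \<open>u\<close> is removed,
  and its other end takes the place of \<open>u\<close>. Edges left over when \<open>v\<close> is
  reached are discarded.\<close>

lemma path_from_boundary:
  assumes "simple_graph V E" "set es \<subseteq> E" "u \<in> V"
    and "\<And>x. x \<in> V \<Longrightarrow> boundary es x = of_bool (x = u) + of_bool (x = v)"
  shows "\<exists>p. path_between V E u p v \<and> length (path_edges p) \<le> length es"
  using assms(2-)
proof (induction "length es" arbitrary: es u rule: less_induct)
  case less
  show ?case
  proof (cases "u = v")
    case True
    then show ?thesis
      using path_between_refl[OF less.prems(2)] by (intro exI[of _ "[u]"]) auto
  next
    case False
    \<comment> \<open>Since \<open>u \<noteq> v\<close>, the boundary at \<open>u\<close> is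
      1.\<close>
    have "\<exists>e\<in>set es. u \<in> e"
    proof (rule ccontr)
      assume "\<not> ?thesis"
      then have "boundary es u = 0"
        by (induction es) auto
      then show False
        using less.prems(2,3) False by auto
    qed
    then obtain e where e: "e \<in> set es" "u \<in> e"
      by blast
    obtain a b where "a \<in> V" "b \<in> V" "a \<noteq> b" "e = {a, b}"
      using assms(1) less.prems(1) e(1) unfolding simple_graph_def by (meson subsetD)
    then obtain w where w: "w \<in> V" "w \<noteq> u" "e = {u, w}"
      using e(2) that[of a] that[of b] by (auto simp: insert_commute)
    have shorter: "Suc (length (remove1 e es)) = length es"
      using e(1) length_pos_if_in_set[OF e(1)] by (simp add: length_remove1)
    \<comment> \<open>The edge \<open>{u, w}\<close> has boundary \<open>u\<close> +
      \<open>w\<close>; adding it to \<open>u\<close> + \<open>v\<close> leaves \<open>w\<close> +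
      \<open>v\<close>.\<close>
    have "\<exists>p. path_between V E w p v \<and> length (path_edges p) \<le> length (remove1 e es)"
    proof (rule less.hyps)
      fix x assume "x \<in> V"
      then have "of_bool (x \<in> e) + boundary (remove1 e es) x = of_bool (x = u) + of_bool (x = v)"
        using less.prems(3) boundary_remove1[OF e(1)] by metis
      then show "boundary (remove1 e es) x = of_bool (x = w) + of_bool (x = v)"
        using w by (cases "boundary (remove1 e es) x") (auto split: if_splits simp: of_bool_def)
    qed (use shorter w less.prems(1) in \<open>auto dest: notin_set_remove1\<close>)
    then obtain p where p: "path_between V E w p v"
        "length (path_edges p) \<le> length (remove1 e es)"
      by blast
    obtain q where "path_between V E u q v" "length (path_edges q) \<le> Suc (length (path_edges p))"
      by (rule path_between_Cons[OF p(1) less.prems(2)]) (use e w less.prems(1) in auto)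
    then show ?thesis
      using p(2) shorter by (intro exI[of _ q]) auto
  qed
qed

section \<open>The cycle space as a kernel\<close>

text \<open>Restates the even-degree condition as linear equations: the cycle space is the kernel of
  the incidence matrix over F_2 on functions supported on \<open>E\<close>.\<close>

lemma cycle_space_iff:
  assumes "finite E"
  shows "f \<in> cycle_space V E \<longleftrightarrow>
    (\<forall>e. e \<notin> E \<longrightarrow> f e = 0) \<and> (\<forall>v\<in>V. (\<Sum>e\<in>E. of_bool (v \<in> e) * f e) = 0)"
proof -
  have degree: "(\<Sum>e\<in>E. of_bool (v \<in> e) * indicator X e :: bit) = of_nat (card {e \<in> X. v \<in> e})"
    if "X \<subseteq> E" for v X
  proof -
    have "(\<Sum>e\<in>E. of_bool (v \<in> e) * indicator X e :: bit) = (\<Sum>e\<in>{e \<in> X. v \<in> e}. 1)"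
      using that assms by (intro sum.mono_neutral_cong_right) (auto simp: indicator_def)
    then show ?thesis
      by simp
  qed
  show ?thesis
  proof
    assume "f \<in> cycle_space V E"
    then obtain X where "f = indicator X" "X \<subseteq> E" "\<forall>v\<in>V. even (card {e \<in> X. v \<in> e})"
      by (auto simp: cycle_space_def)
    then show "(\<forall>e. e \<notin> E \<longrightarrow> f e = 0) \<and> (\<forall>v\<in>V. (\<Sum>e\<in>E. of_bool (v \<in> e) * f e) = 0)"
      using degree by (auto simp: of_nat_bit_eq_0_iff indicator_def)
  next
    assume f: "(\<forall>e. e \<notin> E \<longrightarrow> f e = 0) \<and> (\<forall>v\<in>V. (\<Sum>e\<in>E. of_bool (v \<in> e) * f e) = 0)"
    \<comment> \<open>A function with values in F_2 is the indicator of its support.\<close>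
    have X: "f = indicator {e. f e = 1}" "{e. f e = 1} \<subseteq> E"
      using f by (auto simp: indicator_def fun_eq_iff simp flip: bit_not_zero_iff)
    moreover have "even (card {e \<in> {e. f e = 1}. v \<in> e})" if "v \<in> V" for v
      using f that degree[OF X(2)] X(1) by (simp flip: of_nat_bit_eq_0_iff)
    ultimately show "f \<in> cycle_space V E"
      unfolding cycle_space_def by blast
  qed
qed

text \<open>The sum of indicators records multiplicities modulo 2, and its image under the incidence
  matrix is the boundary of the list.\<close>

lemma edge_list_in_cycle_space_iff:
  assumes "finite E" "set es \<subseteq> E"
  shows "(\<Sum>e\<leftarrow>es. indicator {e}) \<in> cycle_space V E \<longleftrightarrow> (\<forall>v\<in>V. boundary es v = 0)"
proof -
  have "(\<Sum>e\<leftarrow>es. indicator {e}) e' = (0 :: bit)" if "e' \<notin> E" for e'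
    using assms(2) that by (induction es) (auto simp: indicator_def)
  moreover have "(\<Sum>e'\<in>E. of_bool (v \<in> e') * (\<Sum>e\<leftarrow>es. indicator {e}) e') = boundary es v" for v
    using assms(2)
  proof (induction es)
    case (Cons e es)
    have "(\<Sum>e'\<in>E. of_bool (v \<in> e') * indicator {e} e') = (of_bool (v \<in> e) :: bit)"
      using Cons.prems assms(1) by (simp add: indicator_def if_distrib cong: if_cong)
    then show ?case
      using Cons by (simp add: distrib_left sum.distrib)
  qed auto
  ultimately show ?thesis
    using assms(1) by (simp add: cycle_space_iff)
qed

section \<open>The labeling of the all-singleton partition\<close>

locale singleton_labeling =
  fixes V :: "'a set" and E :: "'a set set" and Fs :: "'a set set list" and Bs :: "'a list list"
    and k :: nat and \<phi> :: "(nat \<Rightarrow> bit) set \<Rightarrow> (nat \<Rightarrow> bit)"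
  assumes simple: "simple_graph V E" and finite_V: "finite V"
    and partition: "edge_partition E Fs" and singletons: "set Fs = (\<lambda>e. {e}) ` E"
    and basis: "cycle_basis V E Bs"
    and iso: "\<phi> \<in> iso (quotient_group Bs Fs) (Z2_pow k)"
begin

lemma finite_E: "finite E"
  using simple finite_V by (intro finite_subset[of E "Pow V"]) (auto simp: simple_graph_def)

lemma edge_class:
  assumes "e \<in> E"
  shows "edge_class Fs e < length Fs" "Fs ! edge_class Fs e = {e}"
proof -
  \<comment> \<open>Uniqueness makes the description in \<open>edge_class\<close> meaningful:
    classes are singletons, and distinctness of \<open>Fs\<close> prevents a repeated class.\<close>
  have "\<exists>!j. j < length Fs \<and> e \<in> Fs ! j"
  proof -
    have "{e} \<in> set Fs"
      using assms singletons by blast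
    then obtain j where j: "j < length Fs" "Fs ! j = {e}"
      by (auto simp: in_set_conv_nth)
    moreover have "i = j" if "i < length Fs" "e \<in> Fs ! i" for i
    proof -
      have "Fs ! i \<in> (\<lambda>e. {e}) ` E"
        using that nth_mem singletons by blast
      then have "Fs ! i = Fs ! j"
        using that j by auto
      then show ?thesis
        using that(1) j(1) partition nth_eq_iff_index_eq[of Fs i j] by (simp add: edge_partition_def)
    qed
    ultimately show ?thesis
      by blast
  qed
  then have idx: "edge_class Fs e < length Fs \<and> e \<in> Fs ! edge_class Fs e"
    unfolding edge_class_def by (rule theI')
  then show "edge_class Fs e < length Fs"
    by simp
  obtain e' where "Fs ! edge_class Fs e = {e'}"
    using idx singletons nth_mem[of "edge_class Fs e" Fs] by auto
  then show "Fs ! edge_class Fs e = {e}"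
    using idx by simp
qed

text \<open>Together with \<open>edge_class\<close>, this puts edges and column indices in
  bijection.\<close>

lemma edge_class_surj:
  assumes "j < length Fs"
  obtains e where "e \<in> E" "edge_class Fs e = j"
proof -
  have "Fs ! j \<in> (\<lambda>e. {e}) ` E"
    using assms singletons nth_mem by blast
  then obtain e where "e \<in> E" "Fs ! j = {e}"
    by blast
  moreover from this have "edge_class Fs e = j"
    using edge_class[of e] assms partition nth_eq_iff_index_eq[of Fs "edge_class Fs e" j]
    by (simp add: edge_partition_def)
  ultimately show thesis
    using that by blast
qed

section \<open>The row space as the cycle space\<close>

text \<open>Reindexes coordinates by edges, which identifies Z_2^t with the functions supported on
  \<open>E\<close>, the ambient space of \<open>cycle_space\<close>.\<close>

definition edge_vector :: "(nat \<Rightarrow> bit) \<Rightarrow> ('a set \<Rightarrow> bit)" where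
  "edge_vector x e = (if e \<in> E then x (edge_class Fs e) else 0)"

lemma edge_vector_linear: "module_hom F2_scale F2_scale edge_vector"
  by unfold_locales
    (auto simp: edge_vector_def F2_scale_def fun_eq_iff algebra_simps)

lemma edge_vector_inj: "inj_on edge_vector (carrier (Z2_pow (length Fs)))"
proof (rule inj_onI, rule ext)
  fix x y i
  assume xy: "x \<in> carrier (Z2_pow (length Fs))" "y \<in> carrier (Z2_pow (length Fs))"
    and eq: "edge_vector x = edge_vector y"
  show "x i = y i"
  proof (cases "i < length Fs")
    case True
    then obtain e where "e \<in> E" "edge_class Fs e = i"
      by (rule edge_class_surj)
    then show ?thesis
      using fun_cong[OF eq, of e] by (simp add: edge_vector_def)
  qed (use xy in \<open>auto simp: Z2_pow_def\<close>)
qed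

lemma edge_vector_unit:
  assumes "e \<in> E"
  shows "edge_vector (indicator {edge_class Fs e}) = indicator {e}"
proof
  fix e'
  have "e' = e" if "e' \<in> E" "edge_class Fs e' = edge_class Fs e"
    using that assms edge_class(2) by (metis singleton_inject)
  then show "edge_vector (indicator {edge_class Fs e}) e' = indicator {e} e'"
    using assms by (auto simp: edge_vector_def indicator_def)
qed

lemma rowspan_subset: "rowspan Bs Fs \<subseteq> carrier (Z2_pow (length Fs))"
  unfolding rowspan_def
proof (rule F2.span_minimal)
  show "F2.subspace (carrier (Z2_pow (length Fs)))"
    by (auto simp: F2.subspace_def Z2_pow_def F2_scale_def)
qed (auto simp: parity_matrix_def Z2_pow_def)

text \<open>A class is a single edge, so the parity of its intersection with a cycle is membership
  in that cycle.\<close>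

lemma edge_vector_row:
  assumes "i < length Bs"
  shows "edge_vector (parity_matrix Bs Fs i) = indicator (cycle_edges (Bs ! i))"
proof
  fix e
  have "cycle V E (Bs ! i)"
    using basis assms by (simp add: cycle_basis_def)
  then have "cycle_edges (Bs ! i) \<subseteq> E"
    using set_path_edges_subset by (auto simp: cycle_def path_def cycle_edges_def)
  then show "edge_vector (parity_matrix Bs Fs i) e = indicator (cycle_edges (Bs ! i)) e"
    using assms edge_class[of e] by (auto simp: edge_vector_def parity_matrix_def indicator_def)
qed

text \<open>A linear map sends spans to spans, and the rows become the basis cycles.\<close>

lemma edge_vector_rowspan: "edge_vector ` rowspan Bs Fs = cycle_space V E"
proof -
  have "edge_vector ` parity_matrix Bs Fs ` {..<length Bs}
      = (\<lambda>i. indicator (cycle_edges (Bs ! i))) ` {..<length Bs}"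
    unfolding image_image by (intro image_cong) (auto simp: edge_vector_row)
  also have "\<dots> = set (map (\<lambda>B. indicator (cycle_edges B)) Bs)"
    by (force simp: in_set_conv_nth)
  finally show ?thesis
    using basis module_hom.span_image[OF edge_vector_linear]
    unfolding rowspan_def cycle_basis_def Let_def by metis
qed

lemma mem_rowspan_iff:
  assumes "x \<in> carrier (Z2_pow (length Fs))"
  shows "x \<in> rowspan Bs Fs \<longleftrightarrow> edge_vector x \<in> cycle_space V E"
  using inj_on_image_mem_iff[OF edge_vector_inj assms rowspan_subset] edge_vector_rowspan by simp

section \<open>The quotient map and its kernel\<close>

lemma normal_rowspan: "rowspan Bs Fs \<lhd> Z2_pow (length Fs)"
  using comm_group.normal_iff_subgroup[OF comm_group_Z2_pow]
    subgroup_Z2_powI[OF _ rowspan_subset] by (simp add: rowspan_def)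

lemma quotient_map_hom: "quotient_map \<phi> Bs Fs \<in> hom (Z2_pow (length Fs)) (Z2_pow k)"
proof -
  have "\<phi> \<circ> (\<lambda>x. rowspan Bs Fs #>\<^bsub>Z2_pow (length Fs)\<^esub> x) \<in> hom (Z2_pow (length Fs)) (Z2_pow k)"
    using iso normal.r_coset_hom_Mod[OF normal_rowspan] Group.hom_compose
    unfolding iso_def quotient_group_def by blast
  then show ?thesis
    by (simp add: quotient_map_def[abs_def] comp_def)
qed

lemma quotient_map_add:
  assumes "x \<in> carrier (Z2_pow (length Fs))" "y \<in> carrier (Z2_pow (length Fs))"
  shows "quotient_map \<phi> Bs Fs (x + y) = quotient_map \<phi> Bs Fs x + quotient_map \<phi> Bs Fs y"
  using hom_mult[OF quotient_map_hom assms] by (simp add: Z2_pow_def)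

text \<open>The coset projection has kernel \<open>rowspan Bs Fs\<close>, and the injective
  \<open>\<phi>\<close> does not enlarge it.\<close>

lemma quotient_map_eq_0_iff:
  assumes x: "x \<in> carrier (Z2_pow (length Fs))"
  shows "quotient_map \<phi> Bs Fs x = 0 \<longleftrightarrow> x \<in> rowspan Bs Fs"
proof -
  let ?G = "Z2_pow (length Fs)" and ?H = "rowspan Bs Fs"
  have sub: "subgroup ?H ?G"
    using normal_rowspan by (rule normal_imp_subgroup)
  have grp: "group (quotient_group Bs Fs)"
    unfolding quotient_group_def by (rule normal.factorgroup_is_group[OF normal_rowspan])
  \<comment> \<open>The subgroup itself is the neutral element of the quotient.\<close>
  have one: "\<phi> ?H = 0"
    using hom_one[OF _ grp group_Z2_pow, of \<phi> k] iso
    by (auto simp: iso_def quotient_group_def FactGroup_def Z2_pow_def)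
  have inj: "inj_on \<phi> (carrier (quotient_group Bs Fs))"
    using iso by (simp add: iso_def bij_betw_def)
  have mem: "?H #>\<^bsub>?G\<^esub> x \<in> carrier (quotient_group Bs Fs)"
      "?H \<in> carrier (quotient_group Bs Fs)"
    using x subgroup.subgroup_in_rcosets[OF sub group_Z2_pow]
    by (auto simp: quotient_group_def FactGroup_def RCOSETS_def)
  have "quotient_map \<phi> Bs Fs x = 0 \<longleftrightarrow> ?H #>\<^bsub>?G\<^esub> x = ?H"
    using inj_on_eq_iff[OF inj mem] by (simp add: quotient_map_def one)
  also have "\<dots> \<longleftrightarrow> x \<in> ?H"
    using group.coset_join1[OF group_Z2_pow _ x sub] group.coset_join2[OF group_Z2_pow x sub] by blast
  finally show ?thesis .
qed

section \<open>Labels of edges\<close>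

definition edge_label :: "'a set \<Rightarrow> (nat \<Rightarrow> bit)" where
  "edge_label e = generator \<phi> Bs Fs (edge_class Fs e)"

lemma unit_in_carrier: "e \<in> E \<Longrightarrow> indicator {edge_class Fs e} \<in> carrier (Z2_pow (length Fs))"
  using edge_class(1)[of e] by (auto simp: Z2_pow_def indicator_def)

lemma edge_label_in_carrier: "e \<in> E \<Longrightarrow> edge_label e \<in> carrier (Z2_pow k)"
  unfolding edge_label_def generator_def
  by (rule hom_in_carrier[OF quotient_map_hom unit_in_carrier])

lemma sum_edge_label:
  "set es \<subseteq> E \<Longrightarrow>
    (\<Sum>e\<leftarrow>es. edge_label e) = quotient_map \<phi> Bs Fs (\<Sum>e\<leftarrow>es. indicator {edge_class Fs e})"
proof (induction es)
  case Nil
  have "(0 :: nat \<Rightarrow> bit) \<in> rowspan Bs Fs"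
    by (simp add: rowspan_def F2.span_zero)
  then show ?case
    using quotient_map_eq_0_iff[OF Z2_pow_closed(2)] by (simp del: zero_fun_apply)
next
  case (Cons e es)
  then have "indicator {edge_class Fs e} \<in> carrier (Z2_pow (length Fs))"
    "(\<Sum>e\<leftarrow>es. indicator {edge_class Fs e}) \<in> carrier (Z2_pow (length Fs))"
    by (auto intro: unit_in_carrier Z2_pow_sum_list_closed)
  moreover have "edge_label e = quotient_map \<phi> Bs Fs (indicator {edge_class Fs e})"
    by (simp add: edge_label_def generator_def)
  ultimately show ?case
    using Cons by (simp add: quotient_map_add del: plus_fun_apply)
qed

text \<open>The sum is the image of one vector under the quotient map. It vanishes iff that vector
  is in the row space, that is, iff its edge form is in the cycle space.\<close>

lemma sum_edge_label_eq_0_iff: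
  assumes "set es \<subseteq> E"
  shows "(\<Sum>e\<leftarrow>es. edge_label e) = 0 \<longleftrightarrow> (\<forall>v\<in>V. boundary es v = 0)"
proof -
  have "edge_vector (\<Sum>e\<leftarrow>es. indicator {edge_class Fs e}) = (\<Sum>e\<leftarrow>es. indicator {e})"
    using assms
  proof (induction es)
    case Nil
    then show ?case
      using module_hom.zero[OF edge_vector_linear] by (simp del: zero_fun_apply)
  next
    case (Cons e es)
    then show ?case
      by (simp add: module_hom.add[OF edge_vector_linear] edge_vector_unit del: plus_fun_apply)
  qed
  moreover have "(\<Sum>e\<leftarrow>es. indicator {edge_class Fs e}) \<in> carrier (Z2_pow (length Fs))"
    using assms by (intro Z2_pow_sum_list_closed unit_in_carrier) auto
  ultimately show ?thesis
    using edge_list_in_cycle_space_iff[OF finite_E assms]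
    by (simp add: sum_edge_label[OF assms] quotient_map_eq_0_iff mem_rowspan_iff)
qed

text \<open>A single edge has odd degree at its ends, so it is not in the cycle space.\<close>

lemma edge_label_nonzero:
  assumes "e \<in> E"
  shows "edge_label e \<noteq> 0"
proof -
  obtain v where "v \<in> V" "v \<in> e"
    using simple assms by (auto simp: simple_graph_def)
  then show ?thesis
    using sum_edge_label_eq_0_iff[of "[e]"] assms by auto
qed

lemma connection_set_eq: "connection_set \<phi> Bs Fs = edge_label ` E"
proof (intro equalityI subsetI)
  fix s assume "s \<in> connection_set \<phi> Bs Fs"
  then obtain j where "j < length Fs" "s = generator \<phi> Bs Fs j"
    by (auto simp: connection_set_def)
  then show "s \<in> edge_label ` E"
    using edge_class_surj edge_label_def by (metis imageI)
next
  fix s assume "s \<in> edge_label ` E"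
  then show "s \<in> connection_set \<phi> Bs Fs"
    using edge_class(1) edge_label_nonzero by (auto simp: connection_set_def edge_label_def)
qed

text \<open>Every Cayley step adds the label of some edge of \<open>G\<close>; these edges are
  collected in order and need not be adjacent in \<open>G\<close>.\<close>

lemma cayley_walk_spells_edges:
  assumes "hs \<noteq> []"
    and "successively (\<lambda>x y. {x, y} \<in> cayley_edges k (connection_set \<phi> Bs Fs)) hs"
  shows "\<exists>es. set es \<subseteq> E \<and> length es = length (path_edges hs) \<and>
    last hs = hd hs + (\<Sum>e\<leftarrow>es. edge_label e)"
  using assms
proof (induction hs rule: induct_list012)
  case (3 x y hs)
  then obtain es where es: "set es \<subseteq> E" "length es = length (path_edges (y # hs))"
      "last (y # hs) = y + (\<Sum>e\<leftarrow>es. edge_label e)"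
    by (auto simp del: plus_fun_apply)
  obtain h e where e: "e \<in> E" "{x, y} = {h, h + edge_label e}"
    using 3 by (auto simp: cayley_edges_def connection_set_eq)
  \<comment> \<open>The step may run from \<open>h + edge_label e\<close> back to \<open>h\<close>;
    as the label is its own inverse, both directions give the same equation.\<close>
  then have "y = x + edge_label e"
    by (auto simp: doubleton_eq_iff add.assoc)
  then show ?case
    using es e(1) by (intro exI[of _ "e # es"]) (auto simp: add.assoc simp del: plus_fun_apply)
qed auto

lemma quotient_labeling_edges:
  "quotient_labeling \<phi> Bs Fs P v = (\<Sum>e\<leftarrow>path_edges (P v). edge_label e)"
  by (simp add: quotient_labeling_def edge_label_def)

section \<open>Labels of vertices and the isometry\<close>

context
  fixes r :: 'a and P :: "'a \<Rightarrow> 'a list"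
  assumes paths: "\<And>v. v \<in> V \<Longrightarrow> path_between V E r (P v) v"
begin

abbreviation "lab \<equiv> quotient_labeling \<phi> Bs Fs P"

lemma root_path_edges:
  assumes "v \<in> V"
  shows "set (path_edges (P v)) \<subseteq> E"
    and "boundary (path_edges (P v)) x = of_bool (x = r) + of_bool (x = v)"
  using paths[OF assms] set_path_edges_subset boundary_path_edges[of "P v"]
  by (auto simp: path_between_def path_def)

lemma lab_in_carrier: "v \<in> V \<Longrightarrow> lab v \<in> carrier (Z2_pow k)"
  using root_path_edges(1) unfolding quotient_labeling_edges
  by (intro Z2_pow_sum_list_closed edge_label_in_carrier) auto

text \<open>Joining \<open>es\<close> with the root paths of \<open>u\<close> and \<open>v\<close>
  reduces the claim to a zero label sum. The root occurs in both path boundaries and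
  cancels.\<close>

lemma lab_eq_iff:
  assumes "u \<in> V" "v \<in> V" "set es \<subseteq> E"
  shows "lab v = lab u + (\<Sum>e\<leftarrow>es. edge_label e) \<longleftrightarrow>
    (\<forall>x\<in>V. boundary es x = of_bool (x = u) + of_bool (x = v))"
proof -
  let ?es = "path_edges (P u) @ path_edges (P v) @ es"
  have sub: "set ?es \<subseteq> E"
    using root_path_edges(1) assms by auto
  have "lab v = lab u + s \<longleftrightarrow> lab u + (lab v + s) = 0" for s
    by (simp only: eq_commute[of "lab v" "lab u + s"] bit_fun_add_eq_iff[of "lab u"]
        bit_fun_add_eq_iff[of "lab v"] add_0_right add.commute[of "lab v" "lab u"])
  then have "lab v = lab u + (\<Sum>e\<leftarrow>es. edge_label e) \<longleftrightarrow> (\<Sum>e\<leftarrow>?es. edge_label e) = 0"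
    by (simp add: quotient_labeling_edges)
  also have "\<dots> \<longleftrightarrow> (\<forall>x\<in>V. boundary ?es x = 0)"
    by (rule sum_edge_label_eq_0_iff[OF sub])
  also have "\<dots> \<longleftrightarrow> (\<forall>x\<in>V. boundary es x = of_bool (x = u) + of_bool (x = v))"
  proof (rule ball_cong[OF refl])
    fix x
    show "boundary ?es x = 0 \<longleftrightarrow> boundary es x = of_bool (x = u) + of_bool (x = v)"
      using root_path_edges(2)[OF assms(1)] root_path_edges(2)[OF assms(2)]
      by (cases "boundary es x") auto
  qed
  finally show ?thesis .
qed

lemma lab_edge:
  assumes "x \<in> V" "y \<in> V" "{x, y} \<in> E"
  shows "lab y = lab x + edge_label {x, y}"
proof -
  have "x \<noteq> y"
    using simple assms(3) unfolding simple_graph_def by fastforce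
  then show ?thesis
    using lab_eq_iff[of x y "[{x, y}]"] assms by auto
qed

lemma lab_walk:
  assumes "set p \<subseteq> V" "successively (\<lambda>x y. {x, y} \<in> E) p"
  shows "successively (\<lambda>x y. {x, y} \<in> cayley_edges k (connection_set \<phi> Bs Fs)) (map lab p)"
  unfolding successively_map
proof (rule successively_mono[OF assms(2)])
  fix x y assume "x \<in> set p" "y \<in> set p" and xy: "{x, y} \<in> E"
  then have V: "x \<in> V" "y \<in> V"
    using assms(1) by auto
  \<comment> \<open>\<open>lab_edge\<close> puts the pair into the form \<open>{h, h + s}\<close>;
    \<open>refl\<close> then fixes \<open>h\<close> and \<open>s\<close>.\<close>
  show "{lab x, lab y} \<in> cayley_edges k (connection_set \<phi> Bs Fs)"
    unfolding cayley_edges_def connection_set_eq lab_edge[OF V xy] mem_Collect_eq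
    by (intro exI conjI, rule refl) (use lab_in_carrier[OF V(1)] xy in auto)
qed

lemma cayley_dist_eq:
  assumes "u \<in> V" "v \<in> V"
  shows "cayley_dist k (connection_set \<phi> Bs Fs) (lab u) (lab v) = graph_dist V E u v"
proof (rule antisym)
  \<comment> \<open>Only the distance in \<open>G\<close> is unfolded, so each path of
    \<open>G\<close> has to be matched by a Cayley path that is no longer.\<close>
  show "cayley_dist k (connection_set \<phi> Bs Fs) (lab u) (lab v) \<le> graph_dist V E u v"
    unfolding graph_dist_def[of V]
  proof (rule INF_greatest)
    fix p assume "p \<in> {p. path_between V E u p v}"
    then have p: "p \<noteq> []" "set p \<subseteq> V" "successively (\<lambda>x y. {x, y} \<in> E) p" "hd p = u" "last p = v"
      by (auto simp: path_between_def path_def)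
    obtain q where q: "path_between (carrier (Z2_pow k)) (cayley_edges k (connection_set \<phi> Bs Fs))
        (hd (map lab p)) q (last (map lab p))"
        "length (path_edges q) \<le> length (path_edges (map lab p))"
      using walk_contains_path[OF _ _ lab_walk[OF p(2,3)], of "carrier (Z2_pow k)"]
        p(1,2) lab_in_carrier by auto
    show "cayley_dist k (connection_set \<phi> Bs Fs) (lab u) (lab v) \<le> enat (length (path_edges p))"
      unfolding cayley_dist_def
      by (rule graph_dist_le[of _ _ _ q])
        (use q p in \<open>auto simp: hd_map last_map length_path_edges\<close>)
  qed
next
  \<comment> \<open>Now only the Cayley distance is unfolded, and each Cayley path has to yield a
    path of \<open>G\<close> that is no longer.\<close>
  show "graph_dist V E u v \<le> cayley_dist k (connection_set \<phi> Bs Fs) (lab u) (lab v)"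
    unfolding cayley_dist_def graph_dist_def[of "carrier _"]
  proof (rule INF_greatest)
    fix hs assume "hs \<in> {p. path_between (carrier (Z2_pow k))
      (cayley_edges k (connection_set \<phi> Bs Fs)) (lab u) p (lab v)}"
    then have hs: "hs \<noteq> []" "hd hs = lab u" "last hs = lab v"
      "successively (\<lambda>x y. {x, y} \<in> cayley_edges k (connection_set \<phi> Bs Fs)) hs"
      by (auto simp: path_between_def path_def)
    obtain es where es: "set es \<subseteq> E" "length es = length (path_edges hs)"
        "lab v = lab u + (\<Sum>e\<leftarrow>es. edge_label e)"
      using cayley_walk_spells_edges[OF hs(1,4)] hs(2,3) by auto
    have "\<exists>p. path_between V E u p v \<and> length (path_edges p) \<le> length es"
      using path_from_boundary[OF simple es(1) assms(1)] lab_eq_iff[OF assms es(1)] es(3) by blast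
    then show "graph_dist V E u v \<le> enat (length (path_edges hs))"
      using graph_dist_le es(2) by metis
  qed
qed

end

end

theorem lemma3:
  fixes V :: "'a set" and E :: "'a set set" and Fs :: "'a set set list" and Bs :: "'a list list"
    and k :: nat and \<phi> :: "(nat \<Rightarrow> bit) set \<Rightarrow> (nat \<Rightarrow> bit)"
    and r :: 'a and P :: "'a \<Rightarrow> 'a list"
  assumes "simple_graph V E" and "finite V" and "connected_graph V E"
    and "edge_partition E Fs" and "set Fs = (\<lambda>e. {e}) ` E"
    and "cycle_basis V E Bs"
    and "\<phi> \<in> iso (quotient_group Bs Fs) (Z2_pow k)"
    and "r \<in> V" and "\<forall>v\<in>V. path_between V E r (P v) v"
  shows "\<forall>u\<in>V. \<forall>v\<in>V.
    cayley_dist k (connection_set \<phi> Bs Fs)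
      (quotient_labeling \<phi> Bs Fs P u) (quotient_labeling \<phi> Bs Fs P v) = graph_dist V E u v"
proof -
  interpret singleton_labeling V E Fs Bs k \<phi>
    using assms by unfold_locales
  show ?thesis
    using cayley_dist_eq assms(9) by blast
qed

end
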